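(* Let $k>0$ be real, let $\alpha,\beta,\beta',\gamma,\gamma',x,y\in\mathbb{C}$, and assume that every lower (denominator) parameter occurring in the formula in question is not in $\{0,-k,-2k,\dots\}$. (i) If $|x|<\frac1k$, $|y|<\frac1k$, $\left|\frac{x-y}{1-kx}\right|<\frac1k$, then $$F_{1,k}(\alpha,\beta,\beta';\beta+\beta';x,y)=(1-kx)^{-\frac{\alpha}{k}}\,{}_2F_{1,k}\left[\begin{array}{c}\alpha,\ \beta'\\ \beta+\beta'\end{array};-\frac{x-y}{1-kx}\right].$$ (ii) If $|x|<\frac1k$, $|y|<\frac1k$, $\left|\frac{y-x}{1-ky}\right|<\frac1k$, then $$F_{1,k}(\alpha,\beta,\beta';\beta+\beta';x,y)=(1-ky)^{-\frac{\alpha}{k}}\,{}_2F_{1,k}\left[\begin{array}{c}\alpha,\ \beta\\ \beta+\beta'\end{array};-\frac{y-x}{1-ky}\right].$$ (iii) If $|x|+|y|<\frac1k$, then $$F_{2,k}(\alpha,\beta,\beta';\beta,\gamma';x,y)=(1-kx)^{-\frac{\alpha}{k}}\,{}_2F_{1,k}\left[\begin{array}{c}\alpha,\ \beta'\\ \gamma'\end{array};\frac{y}{1-kx}\right].$$ (iv) If $|x|+|y|<\frac1k$, then $$F_{2,k}(\alpha,\beta,\beta';\gamma,\beta';x,y)=(1-ky)^{-\frac{\alpha}{k}}\,{}_2F_{1,k}\left[\begin{array}{c}\alpha,\ \beta\\ \gamma\end{array};\frac{x}{1-ky}\right].$$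
   Context: For real $k>0$, $a\in\mathbb{C}$ and an integer $n\ge 1$, the Pochhammer $k$-symbol is $(a)_{n,k}=a(a+k)(a+2k)\cdots(a+(n-1)k)$, and $(a)_{0,k}=1$. The $k$-hypergeometric function is $${}_2F_{1,k}\left[\begin{array}{c}\alpha,\ \beta\\ \gamma\end{array};x\right]=\sum_{n=0}^\infty\frac{(\alpha)_{n,k}(\beta)_{n,k}}{(\gamma)_{n,k}}\frac{x^n}{n!},\qquad |x|<\tfrac1k.$$ The first two Appell $k$-functions are $$F_{1,k}(\alpha,\beta,\beta';\gamma;x,y)=\sum_{m,n=0}^\infty\frac{(\alpha)_{m+n,k}(\beta)_{m,k}(\beta')_{n,k}}{(\gamma)_{m+n,k}}\frac{x^m}{m!}\frac{y^n}{n!},\qquad |x|<\tfrac1k,\ |y|<\tfrac1k,$$ $$F_{2,k}(\alpha,\beta,\beta';\gamma,\gamma';x,y)=\sum_{m,n=0}^\infty\frac{(\alpha)_{m+n,k}(\beta)_{m,k}(\beta')_{n,k}}{(\gamma)_{m,k}(\gamma')_{n,k}}\frac{x^m}{m!}\frac{y^n}{n!},\qquad |x|+|y|<\tfrac1k.$$ Complex powers are principal values. *)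

theory Defs
  imports "HOL-Analysis.Analysis"
begin

definition pochhammer_k :: "real \<Rightarrow> complex \<Rightarrow> nat \<Rightarrow> complex" where
  "pochhammer_k k a n = (\<Prod>i<n. a + of_nat i * of_real k)"

definition hyp2F1_k ::
    "real \<Rightarrow> complex \<Rightarrow> complex \<Rightarrow> complex \<Rightarrow> complex \<Rightarrow> complex" where
  "hyp2F1_k k \<alpha> \<beta> \<gamma> x =
     (\<Sum>n. pochhammer_k k \<alpha> n * pochhammer_k k \<beta> n / pochhammer_k k \<gamma> n * (x ^ n / fact n))"

text \<open>
  The double series are unordered sums over all pairs \<open>(m, n)\<close>, i.e. they are read as absolutely
  convergent. If no lower parameter is in the set \<open>poles_k k\<close> below, this is the case for
  \<open>norm x < 1 / k\<close> and \<open>norm y < 1 / k\<close> (first series) and for \<open>norm x + norm y < 1 / k\<close>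
  (second series). Elsewhere \<^const>\<open>infsum\<close> may return its default value \<open>0\<close>.
\<close>

definition appell_F1_k ::
    "real \<Rightarrow> complex \<Rightarrow> complex \<Rightarrow> complex \<Rightarrow> complex \<Rightarrow> complex \<Rightarrow> complex \<Rightarrow> complex" where
  "appell_F1_k k \<alpha> \<beta> \<beta>' \<gamma> x y =
     (\<Sum>\<^sub>\<infinity>(m, n)\<in>UNIV.
        pochhammer_k k \<alpha> (m + n) * pochhammer_k k \<beta> m * pochhammer_k k \<beta>' n
          / pochhammer_k k \<gamma> (m + n)
        * (x ^ m / fact m) * (y ^ n / fact n))"

definition appell_F2_k ::
    "real \<Rightarrow> complex \<Rightarrow> complex \<Rightarrow> complex \<Rightarrow> complex \<Rightarrow> complex \<Rightarrow> complex \<Rightarrow> complex \<Rightarrow> complex"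
  where
  "appell_F2_k k \<alpha> \<beta> \<beta>' \<gamma> \<gamma>' x y =
     (\<Sum>\<^sub>\<infinity>(m, n)\<in>UNIV.
        pochhammer_k k \<alpha> (m + n) * pochhammer_k k \<beta> m * pochhammer_k k \<beta>' n
          / (pochhammer_k k \<gamma> m * pochhammer_k k \<gamma>' n)
        * (x ^ m / fact m) * (y ^ n / fact n))"

definition poles_k :: "real \<Rightarrow> complex set" where
  "poles_k k = {- (of_nat j * of_real k) | j :: nat. True}"

end

theory Submission
  imports Defs "HOL-Complex_Analysis.Complex_Analysis"
begin

text \<open>
  Since \<open>(a)\<^bsub>n,k\<^esub> = k\<^sup>n (a/k)\<^sub>n\<close>, replacing \<open>x, y\<close> by \<open>k x, k y\<close> and every parameter by its
  quotient by \<open>k\<close> turns all four formulas into the classical ones, \<open>k = 1\<close>. The Appell series are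
  symmetric under exchange of the two variables together with their parameters, which turns the first
  and third formulas into the second and fourth.

  In the second Appell series with \<open>\<gamma> = \<beta>\<close> the factors \<open>(\<beta>)\<^sub>m\<close> cancel. What is left is a series
  \<open>\<Sum> (a)\<^sub>m\<^sub>+\<^sub>n d\<^sub>n x\<^sup>m/m! z\<^sup>n/n!\<close>. Writing \<open>(a)\<^sub>m\<^sub>+\<^sub>n = (a)\<^sub>n (a+n)\<^sub>m\<close>, the sum over \<open>m\<close> is the binomial
  series of \<open>(1-x) powr (-a-n)\<close>, and what remains is a series in \<open>z/(1-x)\<close>. The lemma
  \<open>infsum_mixed_term\<close> does this for every sequence \<open>d\<close> of subexponential growth.

  For the first Appell series with \<open>\<gamma> = \<beta> + \<beta>'\<close>, put \<open>y = x + z\<close>. By the Chu-Vandermonde identity,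
  its homogeneous part of each degree equals the homogeneous part of the same degree of the series above
  with \<open>d\<^sub>n = (\<beta>')\<^sub>n / (\<beta> + \<beta>')\<^sub>n\<close> (\<open>F1_term_diagonal_sum\<close>). This gives the formula only for
  \<open>\<bar>x\<bar> + \<bar>y - x\<bar> < 1\<close>, where the second series is sure to converge absolutely. To reach every point allowed by
  the hypotheses, replace \<open>(x, y)\<close> by \<open>(t x, t y)\<close>: both sides are holomorphic in \<open>t\<close> on a
  domain that is starlike about \<open>0\<close> and contains \<open>1\<close>, and they agree near \<open>0\<close>
  (\<open>infsum_F1_term\<close>).
\<close>

section \<open>Double series grouped by total degree\<close>

lemma diagonal_bij_betw:
  "bij_betw (\<lambda>(N, n). (N - n, n)) (Sigma UNIV (\<lambda>N::nat. {..N})) (UNIV :: (nat \<times> nat) set)"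
  by (rule bij_betw_byWitness[where f' = "\<lambda>(m, n). (m + n, n)"]) auto

text \<open>
  Summability over the diagonals is only a condition on single series, so it is the form in which
  absolute convergence of the double series is checked below. The second part identifies the
  unordered double sum with the series of homogeneous parts.
\<close>
lemma diagonal_summable:
  fixes f :: "nat \<times> nat \<Rightarrow> 'a :: banach"
  assumes "summable (\<lambda>N. \<Sum>n\<le>N. norm (f (N - n, n)))"
  shows "f summable_on UNIV"
    and "(\<lambda>N. \<Sum>n\<le>N. f (N - n, n)) sums infsum f UNIV"
proof -
  let ?\<phi> = "\<lambda>(N, n). (N - n, n) :: nat \<times> nat"
  have "(\<lambda>N. \<Sum>n\<le>N. norm (f (N - n, n))) summable_on UNIV"
    by (subst summable_on_UNIV_nonneg_real_iff) (use assms in \<open>auto intro: sum_nonneg\<close>)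
  then have "(\<lambda>p. norm (f (?\<phi> p))) summable_on Sigma UNIV (\<lambda>N. {..N})"
    by (intro summable_on_SigmaI[where g = "\<lambda>N. \<Sum>n\<le>N. norm (f (N - n, n))"])
       (auto intro!: has_sum_finiteI)
  then have "(\<lambda>p. norm (f p)) summable_on UNIV"
    by (subst (asm) summable_on_reindex_bij_betw[OF diagonal_bij_betw, of "\<lambda>p. norm (f p)"])
  then show f: "f summable_on UNIV"
    by (rule abs_summable_summable)
  have "((\<lambda>p. f (?\<phi> p)) has_sum infsum f UNIV) (Sigma UNIV (\<lambda>N. {..N}))"
    using has_sum_reindex_bij_betw[OF diagonal_bij_betw, of f] has_sum_infsum[OF f] by simp
  from has_sum_SigmaD[OF this, of "\<lambda>N. \<Sum>n\<le>N. f (N - n, n)"]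
  show "(\<lambda>N. \<Sum>n\<le>N. f (N - n, n)) sums infsum f UNIV"
    by (auto intro!: has_sum_imp_sums has_sum_finiteI)
qed

section \<open>Subexponential coefficients\<close>

text \<open>
  Equivalently, the power series with coefficients \<open>f\<close> has radius of convergence at least 1. The
  explicit bounds make the class visibly closed under products and can be inserted into double series.
\<close>
definition subexponential :: "(nat \<Rightarrow> complex) \<Rightarrow> bool" where
  "subexponential f \<longleftrightarrow> (\<forall>r>1. \<exists>K\<ge>0. \<forall>n. norm (f n) \<le> K * r ^ n)"

lemma subexponentialE:
  assumes "subexponential f" "r > 1"
  obtains K where "K \<ge> 0" "\<And>n. norm (f n) \<le> K * r ^ n"
  using assms unfolding subexponential_def by blast

text \<open>
  Room for two growth factors: a term bounded by two subexponential factors times \<open>s\<^sup>n\<close> is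
  dominated by the geometric series with ratio \<open>r\<^sup>2 s < 1\<close>.
\<close>
lemma exists_square_less:
  fixes s :: real
  assumes "0 \<le> s" "s < 1"
  obtains r where "r > 1" "r * r * s < 1"
proof
  show "sqrt (2 / (1 + s)) > 1" using assms by simp
  show "sqrt (2 / (1 + s)) * sqrt (2 / (1 + s)) * s < 1"
    using assms by (simp add: field_simps)
qed

lemma subexponential_mult:
  assumes "subexponential f" "subexponential g"
  shows "subexponential (\<lambda>n. f n * g n)"
  unfolding subexponential_def
proof safe
  fix r :: real assume "r > 1"
  then have r: "sqrt r > 1" by simp
  obtain K L where KL: "K \<ge> 0" "\<And>n. norm (f n) \<le> K * sqrt r ^ n"
     "L \<ge> 0" "\<And>n. norm (g n) \<le> L * sqrt r ^ n"
    using assms r by (metis subexponentialE)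
  have "norm (f n * g n) \<le> (K * L) * r ^ n" for n
  proof -
    have "norm (f n * g n) \<le> (K * sqrt r ^ n) * (L * sqrt r ^ n)"
      unfolding norm_mult using KL \<open>r > 1\<close> by (intro mult_mono) auto
    also have "\<dots> = (K * L) * (sqrt r * sqrt r) ^ n"
      unfolding power_mult_distrib by (simp only: mult_ac)
    also have "sqrt r * sqrt r = r" using \<open>r > 1\<close> by simp
    finally show ?thesis .
  qed
  then show "\<exists>K\<ge>0. \<forall>n. norm (f n * g n) \<le> K * r ^ n"
    using KL by (intro exI[of _ "K * L"]) auto
qed

lemma subexponential_summable:
  assumes "subexponential f" "norm z < 1"
  shows "summable (\<lambda>n. f n * z ^ n)"
proof -
  obtain r where r: "r > 1" "r * r * norm z < 1"
    using exists_square_less[OF _ assms(2)] by auto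
  obtain K where K: "K \<ge> 0" "\<And>n. norm (f n) \<le> K * r ^ n"
    using subexponentialE[OF assms(1) r(1)] by blast
  have "r * norm z \<le> r * r * norm z" using r(1) by (intro mult_right_mono) auto
  then have q: "norm (r * norm z) < 1" using r by (simp only: real_norm_def abs_mult abs_norm_cancel abs_of_pos)
  show ?thesis
  proof (rule summable_comparison_test)
    have "norm (f n * z ^ n) \<le> K * (r * norm z) ^ n" for n
      using mult_right_mono[OF K(2)[of n], of "norm z ^ n"]
      by (simp add: norm_mult norm_power power_mult_distrib mult_ac)
    then show "\<exists>N. \<forall>n\<ge>N. norm (f n * z ^ n) \<le> K * (r * norm z) ^ n" by blast
    show "summable (\<lambda>n. K * (r * norm z) ^ n)"
      using q by (intro summable_mult summable_geometric)
  qed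
qed

text \<open>
  For any \<open>r > 1\<close>, all but finitely many steps multiply the norm by at most \<open>r\<close>; the constant
  only has to absorb the finitely many initial terms.
\<close>
lemma subexponential_recurrence:
  assumes rec: "\<And>n. f (Suc n) = q n * f n" and "q \<longlonglongrightarrow> 1"
  shows "subexponential f"
  unfolding subexponential_def
proof safe
  fix r :: real assume r: "r > 1"
  have "(\<lambda>n. norm (q n)) \<longlonglongrightarrow> 1"
    using tendsto_norm[OF \<open>q \<longlonglongrightarrow> 1\<close>] by simp
  then have "eventually (\<lambda>n. norm (q n) < r) sequentially"
    using r by (rule order_tendstoD)
  then obtain N where N: "\<And>n. n \<ge> N \<Longrightarrow> norm (q n) < r"
    by (auto simp: eventually_at_top_linorder)
  define K where "K = (\<Sum>i\<le>N. norm (f i))"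
  have K: "K \<ge> 0" by (simp add: K_def sum_nonneg)
  have small: "norm (f n) \<le> K * r ^ n" if "n \<le> N" for n
  proof -
    have "norm (f n) \<le> K" unfolding K_def using that by (intro member_le_sum) auto
    also have "\<dots> \<le> K * r ^ n" using K r by (simp add: mult_le_cancel_left1)
    finally show ?thesis .
  qed
  have "norm (f n) \<le> K * r ^ n" for n
  proof (induction n)
    case 0
    show ?case by (rule small) simp
  next
    case (Suc n)
    show ?case
    proof (cases "Suc n \<le> N")
      case False
      then have "norm (q n) * norm (f n) \<le> r * (K * r ^ n)"
        using N[of n] Suc r by (intro mult_mono) auto
      then show ?thesis by (simp add: rec norm_mult mult_ac)
    qed (rule small)
  qed
  with K show "\<exists>K\<ge>0. \<forall>n. norm (f n) \<le> K * r ^ n" by blast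
qed

lemma pochhammer_nonzero:
  fixes c :: complex
  assumes "c \<notin> \<int>\<^sub>\<le>\<^sub>0"
  shows "pochhammer c n \<noteq> 0"
  using assms by (auto simp: pochhammer_eq_0_iff)

lemma subexponential_pochhammer_quotient:
  fixes a c :: complex
  assumes "c \<notin> \<int>\<^sub>\<le>\<^sub>0"
  shows "subexponential (\<lambda>n. pochhammer a n / pochhammer c n)"
proof (rule subexponential_recurrence)
  fix n show "pochhammer a (Suc n) / pochhammer c (Suc n) =
      ((a + of_nat n) / (c + of_nat n)) * (pochhammer a n / pochhammer c n)"
    by (simp add: pochhammer_rec')
next
  have nz: "c + of_nat n \<noteq> 0" for n
    using assms by (metis add_eq_0_iff2 minus_of_nat_in_nonpos_Ints)
  have "filterlim (\<lambda>n. c + of_nat n) at_infinity sequentially"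
    by (rule tendsto_add_filterlim_at_infinity[OF tendsto_const tendsto_of_nat])
  then have "(\<lambda>n. 1 + (a - c) / (c + of_nat n)) \<longlonglongrightarrow> 1 + 0"
    by (intro tendsto_add tendsto_const tendsto_divide_0[OF tendsto_const])
  also have "(\<lambda>n. 1 + (a - c) / (c + of_nat n)) = (\<lambda>n. (a + of_nat n) / (c + of_nat n))"
    using nz by (auto simp: fun_eq_iff field_simps)
  finally show "(\<lambda>n. (a + of_nat n) / (c + of_nat n)) \<longlonglongrightarrow> 1" by simp
qed

lemma subexponential_pochhammer_fact: "subexponential (\<lambda>n. pochhammer a n / fact n)"
proof -
  have "(1::complex) \<notin> \<int>\<^sub>\<le>\<^sub>0" by (auto simp: nonpos_Ints_def complex_eq_iff)
  from subexponential_pochhammer_quotient[OF this] show ?thesis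
    by (simp add: pochhammer_fact[symmetric])
qed

section \<open>Summing out one variable with the binomial series\<close>

lemma pochhammer_series:
  fixes a z :: complex
  assumes "norm z < 1"
  shows "(\<lambda>n. pochhammer a n * (z ^ n / fact n)) sums (1 - z) powr (- a)"
proof -
  have "(\<lambda>n. ((- a) gchoose n) * (- z) ^ n) sums (1 + (- z)) powr (- a)"
    using assms by (intro gen_binomial_complex) simp
  also have "(\<lambda>n. ((- a) gchoose n) * (- z) ^ n) = (\<lambda>n. pochhammer a n * (z ^ n / fact n))"
    by (simp add: gbinomial_pochhammer power_minus[of z] fun_eq_iff mult_ac)
  finally show ?thesis by simp
qed

text \<open>
  Term \<open>(m, n)\<close> of a double series in which \<open>m\<close> and \<open>n\<close> are coupled only through \<open>(a)\<^sub>m\<^sub>+\<^sub>n\<close>. Both Appell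
  series reduce to it: the second one directly, the first one after regrouping by degree.
\<close>
definition mixed_term ::
    "complex \<Rightarrow> (nat \<Rightarrow> complex) \<Rightarrow> complex \<Rightarrow> complex \<Rightarrow> nat \<times> nat \<Rightarrow> complex" where
  "mixed_term a d x z = (\<lambda>(m, n). pochhammer a (m + n) * d n * (x ^ m / fact m) * (z ^ n / fact n))"

lemma mixed_term_diagonal:
  assumes "n \<le> N"
  shows "mixed_term a d x z (N - n, n) =
    (pochhammer a N / fact N) * (of_nat (N choose n) * d n * x ^ (N - n) * z ^ n)"
  using assms by (simp add: mixed_term_def binomial_fact mult_ac)

text \<open>
  On the diagonal of degree \<open>N\<close> the terms are those of the binomial expansion of \<open>(x + z)\<^sup>N\<close> times
  subexponential factors, so the norms are dominated by a geometric series whose ratio is slightly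
  larger than \<open>\<bar>x\<bar> + \<bar>z\<bar>\<close>.
\<close>
lemma mixed_term_diagonal_summable:
  assumes d: "subexponential d" and xz: "norm x + norm z < 1"
  shows "summable (\<lambda>N. \<Sum>n\<le>N. norm (mixed_term a d x z (N - n, n)))"
proof -
  obtain r where r: "r > 1" "r * r * (norm x + norm z) < 1"
    using exists_square_less[OF _ xz] by auto
  obtain K where K: "K \<ge> 0" "\<And>n. norm (pochhammer a n / fact n) \<le> K * r ^ n"
    using subexponentialE[OF subexponential_pochhammer_fact r(1)] by blast
  obtain L where L: "L \<ge> 0" "\<And>n. norm (d n) \<le> L * r ^ n"
    using subexponentialE[OF d r(1)] by blast
  show ?thesis
  proof (rule summable_comparison_test)
    have "(\<Sum>n\<le>N. norm (mixed_term a d x z (N - n, n)))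
        \<le> (K * L) * (r * r * (norm x + norm z)) ^ N" for N
    proof -
      have "norm (mixed_term a d x z (N - n, n)) \<le>
          (K * L * (r * r) ^ N) * (of_nat (N choose n) * norm z ^ n * norm x ^ (N - n))"
        if "n \<le> N" for n
      proof -
        have "norm (d n) \<le> L * r ^ N"
          using L(2)[of n] mult_left_mono[OF power_increasing[OF that], of r L] L(1) r(1) by simp
        then have "norm (pochhammer a N / fact N) * norm (d n) \<le> (K * r ^ N) * (L * r ^ N)"
          using K r by (intro mult_mono) auto
        then have "norm (pochhammer a N / fact N) * norm (d n)
            * (of_nat (N choose n) * norm z ^ n * norm x ^ (N - n))
          \<le> (K * r ^ N) * (L * r ^ N) * (of_nat (N choose n) * norm z ^ n * norm x ^ (N - n))"
          by (intro mult_right_mono) auto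
        then show ?thesis
          unfolding mixed_term_diagonal[OF that]
          by (simp add: norm_mult norm_power norm_divide power_mult_distrib mult_ac)
      qed
      then have "(\<Sum>n\<le>N. norm (mixed_term a d x z (N - n, n))) \<le>
          (\<Sum>n\<le>N. (K * L * (r * r) ^ N) * (of_nat (N choose n) * norm z ^ n * norm x ^ (N - n)))"
        by (intro sum_mono) auto
      also have "\<dots> = (K * L * (r * r) ^ N) * (norm z + norm x) ^ N"
        by (simp add: sum_distrib_left[symmetric] binomial_ring)
      finally show ?thesis by (simp add: power_mult_distrib mult_ac add.commute)
    qed
    then show "\<exists>M. \<forall>N\<ge>M. norm (\<Sum>n\<le>N. norm (mixed_term a d x z (N - n, n)))
        \<le> (K * L) * (r * r * (norm x + norm z)) ^ N"
      by (simp add: sum_nonneg)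
    show "summable (\<lambda>N. (K * L) * (r * r * (norm x + norm z)) ^ N)"
      using r by (intro summable_mult summable_geometric) (auto simp: abs_mult)
  qed
qed

text \<open>
  Absolute convergence allows summing over \<open>m\<close> first, where \<open>(a)\<^sub>m\<^sub>+\<^sub>n = (a)\<^sub>n (a+n)\<^sub>m\<close> leaves the
  binomial series of \<open>(1-x) powr (-a-n)\<close>; its factor \<open>1/(1-x)\<^sup>n\<close> is absorbed into \<open>z\<^sup>n\<close>.
\<close>
lemma infsum_mixed_term:
  assumes d: "subexponential d" and xz: "norm x + norm z < 1"
  shows "infsum (mixed_term a d x z) UNIV =
    (1 - x) powr (- a) * (\<Sum>n. pochhammer a n * d n * ((z / (1 - x)) ^ n / fact n))"
proof -
  have x: "norm x < 1" using xz norm_ge_zero[of z] by linarith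
  then have x1: "1 - x \<noteq> 0" by auto
  let ?g = "\<lambda>(n, m). mixed_term a d x z (m, n)"
  have "mixed_term a d x z summable_on UNIV"
    by (rule diagonal_summable(1)[OF mixed_term_diagonal_summable[OF assms]])
  then have "((\<lambda>(m, n). mixed_term a d x z (m, n)) has_sum infsum (mixed_term a d x z) UNIV)
      (UNIV \<times> UNIV)"
    by (simp add: has_sum_infsum)
  then have sum: "(?g has_sum infsum (mixed_term a d x z) UNIV) (UNIV \<times> UNIV)"
    by (subst (asm) has_sum_swap) simp
  have row: "((\<lambda>m. ?g (n, m)) has_sum
      (1 - x) powr (- a) * (pochhammer a n * d n * ((z / (1 - x)) ^ n / fact n))) UNIV" for n
  proof -
    have "(\<lambda>m. mixed_term a d x z (m, n)) summable_on UNIV"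
      using summable_on_SigmaD1[OF has_sum_imp_summable[OF sum]] by auto
    then have 1: "((\<lambda>m. ?g (n, m)) has_sum infsum (\<lambda>m. ?g (n, m)) UNIV) UNIV"
      by (simp add: has_sum_infsum)
    have "(\<lambda>m. (pochhammer a n * d n * (z ^ n / fact n)) *
        (pochhammer (a + of_nat n) m * (x ^ m / fact m))) sums
        ((pochhammer a n * d n * (z ^ n / fact n)) * (1 - x) powr (- (a + of_nat n)))"
      by (rule sums_mult[OF pochhammer_series[OF x]])
    also have "(\<lambda>m. (pochhammer a n * d n * (z ^ n / fact n)) *
        (pochhammer (a + of_nat n) m * (x ^ m / fact m))) = (\<lambda>m. ?g (n, m))"
      by (simp add: mixed_term_def fun_eq_iff add.commute[of _ n] pochhammer_product'[of a n] mult_ac)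
    also have "(1 - x) powr (- (a + of_nat n)) = (1 - x) powr (- a) / (1 - x) ^ n"
      using x1 by (simp add: powr_diff)
    finally have "infsum (\<lambda>m. ?g (n, m)) UNIV =
        (pochhammer a n * d n * (z ^ n / fact n)) * ((1 - x) powr (- a) / (1 - x) ^ n)"
      using has_sum_imp_sums[OF 1] by (rule sums_unique2[symmetric])
    with 1 show ?thesis by (simp add: power_divide mult_ac)
  qed
  have "((\<lambda>n. (1 - x) powr (- a) * (pochhammer a n * d n * ((z / (1 - x)) ^ n / fact n)))
      has_sum infsum (mixed_term a d x z) UNIV) UNIV"
    by (rule has_sum_SigmaD[OF sum row])
  note sums = has_sum_imp_sums[OF this]
  have "summable (\<lambda>n. pochhammer a n * d n * ((z / (1 - x)) ^ n / fact n))"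
    using sums_summable[OF sums] by (rule summable_mult_D) (use x1 in simp)
  from suminf_mult[OF this] sums_unique[OF sums] show ?thesis by simp
qed


section \<open>The first Appell series on the diagonals\<close>

text \<open>
  A two-variable form of the Chu-Vandermonde identity: after expanding \<open>(x + z)\<^sup>n\<close>, the coefficient of
  \<open>x\<^bsup>N-j\<^esup> z\<^sup>j\<close> is a Chu-Vandermonde sum with parameters \<open>b\<close> and \<open>b' + j\<close>.
\<close>
lemma vandermonde_homogeneous:
  fixes b b' x z :: "'a :: comm_ring_1"
  shows "(\<Sum>n\<le>N. of_nat (N choose n) * pochhammer b (N - n) * pochhammer b' n * x ^ (N - n) * (x + z) ^ n)
    = (\<Sum>j\<le>N. of_nat (N choose j) * pochhammer b' j * pochhammer (b + b' + of_nat j) (N - j)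
        * x ^ (N - j) * z ^ j)"
proof -
  let ?t = "\<lambda>n j. of_nat (N choose n) * pochhammer b (N - n) * pochhammer b' n * x ^ (N - n)
      * (of_nat (n choose j) * z ^ j * x ^ (n - j))"
  (* The range of j is extended beyond n, where the binomial coefficient vanishes, so that the two
     sums can be exchanged over a rectangle. *)
  have "(x + z) ^ n = (\<Sum>j\<le>N. of_nat (n choose j) * z ^ j * x ^ (n - j))" if "n \<le> N" for n
  proof -
    have "(x + z) ^ n = (\<Sum>j\<le>n. of_nat (n choose j) * z ^ j * x ^ (n - j))"
      by (subst add.commute) (simp add: binomial_ring)
    also have "\<dots> = (\<Sum>j\<le>N. of_nat (n choose j) * z ^ j * x ^ (n - j))"
      using that by (intro sum.mono_neutral_left) (auto simp: binomial_eq_0)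
    finally show ?thesis .
  qed
  then have "(\<Sum>n\<le>N. of_nat (N choose n) * pochhammer b (N - n) * pochhammer b' n * x ^ (N - n) * (x + z) ^ n)
      = (\<Sum>n\<le>N. \<Sum>j\<le>N. ?t n j)"
    by (intro sum.cong refl) (simp add: sum_distrib_left)
  also have "\<dots> = (\<Sum>j\<le>N. \<Sum>n\<le>N. ?t n j)"
    by (rule sum.swap)
  also have "\<dots> = (\<Sum>j\<le>N. of_nat (N choose j) * pochhammer b' j
      * pochhammer (b + b' + of_nat j) (N - j) * x ^ (N - j) * z ^ j)"
  proof (rule sum.cong[OF refl])
    fix j assume "j \<in> {..N}"
    then have j: "j \<le> N" by simp
    have "(\<Sum>n\<le>N. ?t n j) = (\<Sum>n\<in>{j..N}. ?t n j)"
      by (intro sum.mono_neutral_right) (auto simp: binomial_eq_0)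
    also have "\<dots> = (\<Sum>i\<le>N - j. ?t (i + j) j)"
      using j by (intro sum.reindex_bij_witness[of _ "\<lambda>i. i + j" "\<lambda>n. n - j"]) auto
    also have "\<dots> = (\<Sum>i\<le>N - j. (of_nat (N choose j) * pochhammer b' j * x ^ (N - j) * z ^ j) *
        (of_nat ((N - j) choose i) * pochhammer (b' + of_nat j) i * pochhammer b (N - j - i)))"
    proof (rule sum.cong[OF refl])
      fix i assume "i \<in> {..N - j}"
      then have i: "i + j \<le> N" using j by auto
      have 1: "of_nat (N choose (i + j)) * of_nat ((i + j) choose j)
          = (of_nat (N choose j) * of_nat ((N - j) choose i) :: 'a)"
        using choose_mult[of j "i + j" N] i unfolding of_nat_mult[symmetric] by simp
      have 2: "pochhammer b' (i + j) = pochhammer b' j * pochhammer (b' + of_nat j) i"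
        using pochhammer_product'[of b' j i] by (simp add: add.commute)
      have 3: "x ^ (N - (i + j)) * x ^ (i + j - j) = x ^ (N - j)"
        using i by (simp flip: power_add)
      have 4: "N - (i + j) = N - j - i" by simp
      have "?t (i + j) j = (of_nat (N choose (i + j)) * of_nat ((i + j) choose j))
          * pochhammer b' (i + j) * (x ^ (N - (i + j)) * x ^ (i + j - j)) * z ^ j
          * pochhammer b (N - (i + j))"
        by (simp only: mult_ac)
      then show "?t (i + j) j = (of_nat (N choose j) * pochhammer b' j * x ^ (N - j) * z ^ j) *
        (of_nat ((N - j) choose i) * pochhammer (b' + of_nat j) i * pochhammer b (N - j - i))"
        unfolding 1 2 3 unfolding 4 by (simp only: mult_ac)
    qed
    also have "\<dots> = (of_nat (N choose j) * pochhammer b' j * x ^ (N - j) * z ^ j)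
        * pochhammer (b' + of_nat j + b) (N - j)"
      by (simp add: pochhammer_binomial_sum sum_distrib_left)
    finally show "(\<Sum>n\<le>N. ?t n j) = of_nat (N choose j) * pochhammer b' j
      * pochhammer (b + b' + of_nat j) (N - j) * x ^ (N - j) * z ^ j"
      by (simp add: add_ac mult_ac)
  qed
  finally show ?thesis .
qed

definition F1_term ::
    "complex \<Rightarrow> complex \<Rightarrow> complex \<Rightarrow> complex \<Rightarrow> complex \<Rightarrow> complex \<Rightarrow> nat \<times> nat \<Rightarrow> complex" where
  "F1_term a b b' c x y = (\<lambda>(m, n). pochhammer a (m + n) * pochhammer b m * pochhammer b' n
     / pochhammer c (m + n) * (x ^ m / fact m) * (y ^ n / fact n))"

text \<open>
  This is where the lower parameter has to be \<open>b + b'\<close>: the Chu-Vandermonde sum produces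
  \<open>(b + b' + n)\<^sub>N\<^sub>-\<^sub>n\<close>, which cancels all of \<open>(b + b')\<^sub>N\<close> except \<open>(b + b')\<^sub>n\<close>.
\<close>
lemma F1_term_diagonal_sum:
  assumes c: "b + b' \<notin> \<int>\<^sub>\<le>\<^sub>0"
  shows "(\<Sum>n\<le>N. F1_term a b b' (b + b') x y (N - n, n))
    = (\<Sum>n\<le>N. mixed_term a (\<lambda>n. pochhammer b' n / pochhammer (b + b') n) x (y - x) (N - n, n))"
proof -
  have "(\<Sum>n\<le>N. F1_term a b b' (b + b') x y (N - n, n))
      = (\<Sum>n\<le>N. pochhammer a N / (pochhammer (b + b') N * fact N) *
          (of_nat (N choose n) * pochhammer b (N - n) * pochhammer b' n * x ^ (N - n) * (x + (y - x)) ^ n))"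
    by (intro sum.cong) (auto simp: F1_term_def binomial_fact mult_ac)
  also have "\<dots> = (\<Sum>n\<le>N. pochhammer a N / (pochhammer (b + b') N * fact N) *
        (of_nat (N choose n) * pochhammer b' n * pochhammer (b + b' + of_nat n) (N - n)
          * x ^ (N - n) * (y - x) ^ n))"
    unfolding sum_distrib_left[symmetric] vandermonde_homogeneous ..
  also have "\<dots> = (\<Sum>n\<le>N. mixed_term a (\<lambda>n. pochhammer b' n / pochhammer (b + b') n) x (y - x) (N - n, n))"
  proof (rule sum.cong[OF refl])
    fix n assume "n \<in> {..N}"
    then have n: "n \<le> N" by simp
    have split: "pochhammer (b + b') N
        = pochhammer (b + b') n * pochhammer (b + b' + of_nat n) (N - n)"
      by (rule pochhammer_product[OF n])
    have "pochhammer (b + b') N \<noteq> 0" by (rule pochhammer_nonzero[OF c])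
    then have nz: "pochhammer (b + b') n \<noteq> 0" "pochhammer (b + b' + of_nat n) (N - n) \<noteq> 0"
      unfolding split by auto
    show "pochhammer a N / (pochhammer (b + b') N * fact N) *
        (of_nat (N choose n) * pochhammer b' n * pochhammer (b + b' + of_nat n) (N - n)
          * x ^ (N - n) * (y - x) ^ n)
      = mixed_term a (\<lambda>n. pochhammer b' n / pochhammer (b + b') n) x (y - x) (N - n, n)"
      unfolding mixed_term_diagonal[OF n] split using nz by (simp add: field_simps)
  qed
  finally show ?thesis .
qed

text \<open>
  With the quotients \<open>(a)\<^sub>N/(c)\<^sub>N\<close>, \<open>(b)\<^sub>m/m!\<close> and \<open>(b')\<^sub>n/n!\<close> subexponential and \<open>s\<close> the larger of
  \<open>\<bar>x\<bar>\<close> and \<open>\<bar>y\<bar>\<close>, each of the \<open>N + 1\<close> terms of degree \<open>N\<close> is bounded by a constant times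
  \<open>(r\<^sup>2 s)\<^sup>N\<close>.
\<close>
lemma F1_term_diagonal_summable:
  assumes c: "c \<notin> \<int>\<^sub>\<le>\<^sub>0" and xy: "norm x < 1" "norm y < 1"
  shows "summable (\<lambda>N. \<Sum>n\<le>N. norm (F1_term a b b' c x y (N - n, n)))"
proof -
  define s where "s = max (norm x) (norm y)"
  have s: "0 \<le> s" "s < 1" "norm x \<le> s" "norm y \<le> s" using xy by (auto simp: s_def max_def)
  obtain r where r: "r > 1" "r * r * s < 1" using exists_square_less[OF s(1,2)] .
  obtain K where K: "K \<ge> 0" "\<And>n. norm (pochhammer a n / pochhammer c n) \<le> K * r ^ n"
    using subexponentialE[OF subexponential_pochhammer_quotient[OF c] r(1)] by blast
  obtain L where L: "L \<ge> 0" "\<And>n. norm (pochhammer b n / fact n) \<le> L * r ^ n"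
    using subexponentialE[OF subexponential_pochhammer_fact r(1)] by blast
  obtain M where M: "M \<ge> 0" "\<And>n. norm (pochhammer b' n / fact n) \<le> M * r ^ n"
    using subexponentialE[OF subexponential_pochhammer_fact r(1)] by blast
  have q: "0 \<le> r * r * s" using r s by simp
  show ?thesis
  proof (rule summable_comparison_test)
    have "(\<Sum>n\<le>N. norm (F1_term a b b' c x y (N - n, n)))
        \<le> (K * L * M) * (of_nat (Suc N) * (r * r * s) ^ N)" for N
    proof -
      have "norm (F1_term a b b' c x y (N - n, n)) \<le> (K * L * M) * (r * r * s) ^ N" if n: "n \<le> N" for n
      proof -
        have "F1_term a b b' c x y (N - n, n) = (pochhammer a N / pochhammer c N)
            * (pochhammer b (N - n) / fact (N - n)) * (pochhammer b' n / fact n)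
            * (x ^ (N - n) * y ^ n)"
          using n by (simp add: F1_term_def)
        also have "norm \<dots> \<le> (K * r ^ N) * (L * r ^ (N - n)) * (M * r ^ n) * (s ^ (N - n) * s ^ n)"
          unfolding norm_mult norm_power using K L M s r
          by (intro mult_mono power_mono mult_nonneg_nonneg zero_le_power norm_ge_zero) auto
        also have "\<dots> = (K * L * M) * (r ^ N * (r ^ (N - n) * r ^ n) * (s ^ (N - n) * s ^ n))"
          by (simp only: mult_ac)
        also have "\<dots> = (K * L * M) * (r * r * s) ^ N"
          using n by (simp add: power_mult_distrib flip: power_add)
        finally show ?thesis .
      qed
      then have "(\<Sum>n\<le>N. norm (F1_term a b b' c x y (N - n, n))) \<le> (\<Sum>n\<le>N. (K * L * M) * (r * r * s) ^ N)"
        by (intro sum_mono) auto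
      then show ?thesis by (simp add: mult_ac)
    qed
    then show "\<exists>M'. \<forall>N\<ge>M'. norm (\<Sum>n\<le>N. norm (F1_term a b b' c x y (N - n, n)))
        \<le> (K * L * M) * (of_nat (Suc N) * (r * r * s) ^ N)"
      by (simp add: sum_nonneg del: of_nat_Suc)
    show "summable (\<lambda>N. (K * L * M) * (of_nat (Suc N) * (r * r * s) ^ N))"
      using geometric_deriv_sums[of "r * r * s"] q r
      by (intro summable_mult) (auto dest: sums_summable)
  qed
qed

text \<open>
  If \<open>\<bar>x\<bar> + \<bar>y - x\<bar> < 1\<close>, then also \<open>\<bar>y\<bar> < 1\<close>. Hence the first Appell series and the mixed series in \<open>(x, y - x)\<close> both converge
  absolutely, so equality of their homogeneous parts gives equality of the sums.
\<close>
lemma infsum_F1_term_local: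
  assumes c: "b + b' \<notin> \<int>\<^sub>\<le>\<^sub>0" and xy: "norm x + norm (y - x) < 1"
  shows "infsum (F1_term a b b' (b + b') x y) UNIV = (1 - x) powr (- a) *
    (\<Sum>n. pochhammer a n * (pochhammer b' n / pochhammer (b + b') n) * (((y - x) / (1 - x)) ^ n / fact n))"
proof -
  note d = subexponential_pochhammer_quotient[OF c, of b']
  have "norm x < 1" "norm y < 1"
    using xy norm_triangle_ineq[of x "y - x"] norm_ge_zero[of "y - x"] by (simp_all del: norm_ge_zero)
  then have "(\<lambda>N. \<Sum>n\<le>N. F1_term a b b' (b + b') x y (N - n, n))
      sums infsum (F1_term a b b' (b + b') x y) UNIV"
    by (intro diagonal_summable F1_term_diagonal_summable c)
  moreover have "(\<lambda>N. \<Sum>n\<le>N. F1_term a b b' (b + b') x y (N - n, n))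
      sums infsum (mixed_term a (\<lambda>n. pochhammer b' n / pochhammer (b + b') n) x (y - x)) UNIV"
    unfolding F1_term_diagonal_sum[OF c]
    by (rule diagonal_summable(2)[OF mixed_term_diagonal_summable[OF d xy]])
  ultimately show ?thesis
    unfolding infsum_mixed_term[OF d xy, symmetric] by (rule sums_unique2)
qed

section \<open>Continuation along the ray to the point\<close>

text \<open>
  The reason why the domain of the continuation is starlike. The point \<open>1 - s x\<close> is
  \<open>s (1 - x)\<close> shifted by the nonnegative real \<open>1 - s\<close>, and such a shift does not decrease
  the norm in the half plane of nonnegative real part, to which \<open>s (1 - x)\<close> belongs.
\<close>
lemma norm_less_one_minus_scaled:
  fixes x w :: complex
  assumes "norm x \<le> 1" "norm w < norm (1 - x)" "0 \<le> s" "s \<le> 1"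
  shows "norm (of_real s * w) < norm (1 - of_real s * x)"
proof (cases "s = 0")
  case False
  define u where "u = of_real s * (1 - x)"
  have "Re x \<le> 1" using assms(1) complex_Re_le_cmod[of x] by linarith
  then have "0 \<le> Re u" using assms by (simp add: u_def)
  have "norm (of_real s * w) < norm u"
    using assms False by (simp add: u_def norm_mult)
  also have "norm u \<le> norm (of_real (1 - s) + u)"
    unfolding cmod_def using \<open>0 \<le> Re u\<close> assms(4) by (auto intro!: add_mono power_mono)
  also have "of_real (1 - s) + u = 1 - of_real s * x"
    by (simp add: u_def algebra_simps)
  finally show ?thesis .
qed auto

text \<open>
  The mixed series may diverge at \<open>(x, y - x)\<close>, but on the segment from \<open>0\<close> to \<open>(x, y)\<close> neither side
  has a singularity. With \<open>w = y - x\<close> they are continued from \<open>t = 0\<close> to \<open>t = 1\<close>, on the left as a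
  power series in \<open>t\<close> given by the homogeneous parts, on the right as a composition with
  \<open>t w / (1 - t x)\<close>.
\<close>
lemma infsum_F1_term:
  assumes c: "b + b' \<notin> \<int>\<^sub>\<le>\<^sub>0"
    and x: "norm x < 1" and y: "norm y < 1" and xy: "norm ((y - x) / (1 - x)) < 1"
  shows "infsum (F1_term a b b' (b + b') x y) UNIV = (1 - x) powr (- a) *
    (\<Sum>n. pochhammer a n * (pochhammer b' n / pochhammer (b + b') n) * (((y - x) / (1 - x)) ^ n / fact n))"
proof -
  define w where "w = y - x"
  define h where "h n = pochhammer a n / fact n * (pochhammer b' n / pochhammer (b + b') n)" for n
  define H where "H v = (\<Sum>n. h n * v ^ n)" for v
  define F where "F t = infsum (F1_term a b b' (b + b') (t * x) (t * y)) UNIV" for t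
  define G where "G t = (1 - t * x) powr (- a) * H (t * w / (1 - t * x))" for t
  define s where "s = max (norm x) (norm y)"
  (* A disc about 0 that contains t = 1 and on which norm (t x) and norm (t y) stay below 1. *)
  define R where "R = 2 / (1 + s)"
  have s: "0 \<le> s" "s < 1" "norm x \<le> s" "norm y \<le> s" using x y by (auto simp: s_def max_def)
  have R: "R > 1" "R * s < 1" using s by (simp_all add: R_def field_simps)
  have scaled: "norm (t * v) < 1" if "norm t < R" "norm v \<le> s" for t v :: complex
  proof -
    have "norm (t * v) \<le> R * s"
      unfolding norm_mult using that R s by (intro mult_mono) auto
    with R show ?thesis by simp
  qed
  have nz: "1 - t * x \<noteq> 0" if "norm t < R" for t
    using scaled[OF that s(3)] by auto
  have H_eq: "(\<Sum>n. pochhammer a n * (pochhammer b' n / pochhammer (b + b') n) * (v ^ n / fact n)) = H v" for v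
    by (simp add: H_def h_def mult_ac)

  (* D is where both sides are holomorphic, U is where the local formula applies. *)
  define D where "D = {t. norm t < R \<and> norm (t * w) < norm (1 - t * x)}"
  define U where "U = {t. norm t < R \<and> norm (t * x) + norm (t * w) < 1}"

  have "F 1 = G 1"
  proof (rule analytic_continuation_open[of U D F G])
    show "open U"
      unfolding U_def by (intro open_Collect_conj open_Collect_less continuous_intros)
    show "open D"
      unfolding D_def by (intro open_Collect_conj open_Collect_less continuous_intros)
    have "0 \<in> U" using R by (simp add: U_def)
    then show "U \<noteq> {}" by auto
    show "U \<subseteq> D"
    proof
      fix t assume t: "t \<in> U"
      have "norm (1::complex) - norm (t * x) \<le> norm (1 - t * x)" by (rule norm_triangle_ineq2)
      with t show "t \<in> D" by (auto simp: U_def D_def)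
    qed
    show "connected D"
    proof (rule starlike_imp_connected, unfold starlike_def, intro bexI ballI subsetI)
      show "0 \<in> D" using R by (simp add: D_def)
      fix t v assume t: "t \<in> D" and "v \<in> closed_segment 0 t"
      then obtain q where q: "0 \<le> q" "q \<le> 1" "v = of_real q * t"
        by (auto simp: in_segment scaleR_conv_of_real)
      have "q * norm t \<le> norm t" using q by (simp add: mult_left_le_one_le)
      then have "norm v < R" using t q by (simp add: D_def norm_mult)
      moreover have "norm (of_real q * (t * w)) < norm (1 - of_real q * (t * x))"
        using t q scaled[of t x] s by (intro norm_less_one_minus_scaled) (auto simp: D_def less_imp_le)
      ultimately show "v \<in> D" by (simp add: D_def q(3) mult.assoc)
    qed
    show "F holomorphic_on D"
    proof (rule holomorphic_on_subset)
      show "F holomorphic_on ball 0 R"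
      proof (rule power_series_holomorphic)
        fix t :: complex assume "t \<in> ball 0 R"
        then have t: "norm t < R" by simp
        have "(\<lambda>N. \<Sum>n\<le>N. F1_term a b b' (b + b') (t * x) (t * y) (N - n, n)) sums F t"
          unfolding F_def using scaled[OF t] s
          by (intro diagonal_summable(2) F1_term_diagonal_summable c) auto
        moreover have "(\<Sum>n\<le>N. F1_term a b b' (b + b') (t * x) (t * y) (N - n, n))
            = (\<Sum>n\<le>N. F1_term a b b' (b + b') x y (N - n, n)) * (t - 0) ^ N" for N
          unfolding sum_distrib_right
        proof (rule sum.cong[OF refl])
          fix n assume "n \<in> {..N}"
          then have "t ^ N = t ^ (N - n) * t ^ n" by (simp flip: power_add)
          then show "F1_term a b b' (b + b') (t * x) (t * y) (N - n, n)
              = F1_term a b b' (b + b') x y (N - n, n) * (t - 0) ^ N"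
            by (simp add: F1_term_def power_mult_distrib mult_ac)
        qed
        ultimately show "(\<lambda>N. (\<Sum>n\<le>N. F1_term a b b' (b + b') x y (N - n, n)) * (t - 0) ^ N) sums F t"
          by simp
      qed
    qed (auto simp: D_def)
    show "G holomorphic_on D"
      unfolding G_def
    proof (intro holomorphic_on_mult holomorphic_on_powr holomorphic_intros)
      fix t assume "t \<in> D"
      then have "norm (t * x) < 1" using scaled[of t x] s by (simp add: D_def)
      then have "Re (t * x) < 1" using complex_Re_le_cmod[of "t * x"] by linarith
      then show "1 - t * x \<notin> \<real>\<^sub>\<le>\<^sub>0" by (auto simp: complex_nonpos_Reals_iff)
    next
      have sub: "subexponential h"
        unfolding h_def
        by (intro subexponential_mult subexponential_pochhammer_fact
            subexponential_pochhammer_quotient c)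
      have "H holomorphic_on ball 0 1"
        by (rule power_series_holomorphic)
           (auto simp: H_def intro!: summable_sums subexponential_summable[OF sub])
      then have "(H \<circ> (\<lambda>t. t * w / (1 - t * x))) holomorphic_on D"
      proof (rule holomorphic_on_compose_gen[rotated])
        show "(\<lambda>t. t * w / (1 - t * x)) holomorphic_on D"
          by (intro holomorphic_intros) (auto simp: D_def nz)
        show "(\<lambda>t. t * w / (1 - t * x)) ` D \<subseteq> ball 0 1"
          using nz by (auto simp: D_def norm_divide divide_simps)
      qed
      then show "(\<lambda>t. H (t * w / (1 - t * x))) holomorphic_on D"
        by (simp add: o_def)
    qed
    show "F t = G t" if "t \<in> U" for t
    proof -
      have "norm (t * x) + norm (t * y - t * x) < 1"
        using that by (simp add: U_def w_def algebra_simps)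
      from infsum_F1_term_local[OF c this, of a] show ?thesis
        unfolding H_eq F_def G_def by (simp add: w_def right_diff_distrib)
    qed
    have "1 - x \<noteq> 0" using x by auto
    with xy have "norm w < norm (1 - x)"
      by (simp add: w_def norm_divide)
    then show "1 \<in> D" using R by (simp add: D_def)
  qed
  then show ?thesis
    unfolding H_eq by (simp add: F_def G_def w_def)
qed

section \<open>Scaling out the parameter k\<close>

lemma pochhammer_k_conv_pochhammer:
  assumes "k \<noteq> 0"
  shows "pochhammer_k k a n = of_real k ^ n * pochhammer (a / of_real k) n"
proof -
  have "a + of_nat i * of_real k = of_real k * (a / of_real k + of_nat i)" for i
    using assms by (simp add: field_simps)
  then show ?thesis
    by (simp add: pochhammer_k_def pochhammer_prod prod.distrib lessThan_atLeast0)
qed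

lemma poles_k_iff:
  assumes "k \<noteq> 0"
  shows "a \<in> poles_k k \<longleftrightarrow> a / of_real k \<in> \<int>\<^sub>\<le>\<^sub>0"
proof -
  have "a = - (of_nat j * of_real k) \<longleftrightarrow> a / of_real k = - of_nat j" for j
    using assms by (simp add: field_simps)
  then show ?thesis
    unfolding poles_k_def by (auto elim!: nonpos_Ints_cases')
qed

lemma hyp2F1_k_conv_pochhammer:
  assumes "k \<noteq> 0"
  shows "hyp2F1_k k a b c z = (\<Sum>n. pochhammer (a / of_real k) n *
    (pochhammer (b / of_real k) n / pochhammer (c / of_real k) n) * ((of_real k * z) ^ n / fact n))"
  using assms unfolding hyp2F1_k_def pochhammer_k_conv_pochhammer[OF assms]
  by (simp add: power_mult_distrib mult_ac)

lemma appell_F1_k_conv_F1_term: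
  assumes "k \<noteq> 0"
  shows "appell_F1_k k a b b' c x y = infsum (F1_term (a / of_real k) (b / of_real k)
    (b' / of_real k) (c / of_real k) (of_real k * x) (of_real k * y)) UNIV"
  using assms unfolding appell_F1_k_def pochhammer_k_conv_pochhammer[OF assms] F1_term_def
  by (simp add: power_mult_distrib power_add mult_ac)

text \<open>
  The hypothesis on \<open>b\<close> makes every \<open>(b)\<^sub>m\<close> nonzero, so that the equal upper and lower parameters
  cancel.
\<close>
lemma appell_F2_k_conv_mixed_term:
  assumes "k \<noteq> 0" "b \<notin> poles_k k"
  shows "appell_F2_k k a b b' b c x y = infsum (mixed_term (a / of_real k)
    (\<lambda>n. pochhammer (b' / of_real k) n / pochhammer (c / of_real k) n)
    (of_real k * x) (of_real k * y)) UNIV"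
  using assms pochhammer_nonzero[of "b / of_real k"]
  unfolding appell_F2_k_def pochhammer_k_conv_pochhammer[OF assms(1)] mixed_term_def poles_k_iff[OF assms(1)]
  by (simp add: power_mult_distrib power_add mult_ac)

lemma appell_F1_k_swap: "appell_F1_k k a b b' c x y = appell_F1_k k a b' b c y x"
  unfolding appell_F1_k_def
  by (rule infsum_reindex_bij_witness[of _ prod.swap prod.swap]) (auto simp: add.commute mult_ac)

lemma appell_F2_k_swap: "appell_F2_k k a b b' c c' x y = appell_F2_k k a b' b c' c y x"
  unfolding appell_F2_k_def
  by (rule infsum_reindex_bij_witness[of _ prod.swap prod.swap]) (auto simp: add.commute mult_ac)

section \<open>The reduction formulas\<close>

lemma appell_F1_k_reduction:
  assumes k: "k > 0" and c: "b + b' \<notin> poles_k k"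
    and x: "norm x < 1 / k" and y: "norm y < 1 / k" and xy: "norm ((x - y) / (1 - of_real k * x)) < 1 / k"
  shows "appell_F1_k k a b b' (b + b') x y = (1 - of_real k * x) powr (- (a / of_real k))
      * hyp2F1_k k a b' (b + b') (- ((x - y) / (1 - of_real k * x)))"
proof -
  have k0: "k \<noteq> 0" using k by simp
  have arg: "of_real k * (- ((x - y) / (1 - of_real k * x)))
      = (of_real k * y - of_real k * x) / (1 - of_real k * x)"
    by (simp add: algebra_simps minus_divide_left)
  have "k * norm ((x - y) / (1 - of_real k * x)) < 1"
    using xy k by (simp add: field_simps)
  also have "k * norm ((x - y) / (1 - of_real k * x))
      = norm (of_real k * (- ((x - y) / (1 - of_real k * x))))"
    using k by (simp only: norm_mult norm_minus_cancel norm_of_real abs_of_pos)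
  finally have xy': "norm ((of_real k * y - of_real k * x) / (1 - of_real k * x)) < 1"
    unfolding arg .
  have "norm (of_real k * x) < 1" "norm (of_real k * y) < 1"
    using x y k by (simp_all add: norm_mult field_simps)
  moreover have "b / of_real k + b' / of_real k \<notin> \<int>\<^sub>\<le>\<^sub>0"
    using c by (simp add: poles_k_iff[OF k0] add_divide_distrib)
  ultimately show ?thesis
    unfolding appell_F1_k_conv_F1_term[OF k0] hyp2F1_k_conv_pochhammer[OF k0] arg add_divide_distrib
    using xy' by (intro infsum_F1_term)
qed

lemma appell_F2_k_reduction:
  assumes k: "k > 0" and b: "b \<notin> poles_k k" and c: "c \<notin> poles_k k"
    and xy: "norm x + norm y < 1 / k"
  shows "appell_F2_k k a b b' b c x y = (1 - of_real k * x) powr (- (a / of_real k))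
      * hyp2F1_k k a b' c (y / (1 - of_real k * x))"
proof -
  have k0: "k \<noteq> 0" using k by simp
  have "norm (of_real k * x) + norm (of_real k * y) < 1"
    using xy k by (simp add: norm_mult field_simps)
  moreover have "subexponential (\<lambda>n. pochhammer (b' / of_real k) n / pochhammer (c / of_real k) n)"
    using c by (intro subexponential_pochhammer_quotient) (simp add: poles_k_iff[OF k0])
  ultimately show ?thesis
    unfolding appell_F2_k_conv_mixed_term[OF k0 b] hyp2F1_k_conv_pochhammer[OF k0]
    by (subst infsum_mixed_term) simp_all
qed

theorem theorem13:
  fixes k :: real and \<alpha> \<beta> \<beta>' \<gamma> \<gamma>' x y :: complex
  assumes "k > 0"
  shows
    "(\<beta> + \<beta>' \<notin> poles_k k \<longrightarrow>
      norm x < 1 / k \<longrightarrow> norm y < 1 / k \<longrightarrow> norm ((x - y) / (1 - of_real k * x)) < 1 / k \<longrightarrow>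
        appell_F1_k k \<alpha> \<beta> \<beta>' (\<beta> + \<beta>') x y
          = (1 - of_real k * x) powr (- (\<alpha> / of_real k))
            * hyp2F1_k k \<alpha> \<beta>' (\<beta> + \<beta>') (- ((x - y) / (1 - of_real k * x)))) \<and>
     (\<beta> + \<beta>' \<notin> poles_k k \<longrightarrow>
      norm x < 1 / k \<longrightarrow> norm y < 1 / k \<longrightarrow> norm ((y - x) / (1 - of_real k * y)) < 1 / k \<longrightarrow>
        appell_F1_k k \<alpha> \<beta> \<beta>' (\<beta> + \<beta>') x y
          = (1 - of_real k * y) powr (- (\<alpha> / of_real k))
            * hyp2F1_k k \<alpha> \<beta> (\<beta> + \<beta>') (- ((y - x) / (1 - of_real k * y)))) \<and>
     (\<beta> \<notin> poles_k k \<longrightarrow> \<gamma>' \<notin> poles_k k \<longrightarrow>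
      norm x + norm y < 1 / k \<longrightarrow>
        appell_F2_k k \<alpha> \<beta> \<beta>' \<beta> \<gamma>' x y
          = (1 - of_real k * x) powr (- (\<alpha> / of_real k))
            * hyp2F1_k k \<alpha> \<beta>' \<gamma>' (y / (1 - of_real k * x))) \<and>
     (\<gamma> \<notin> poles_k k \<longrightarrow> \<beta>' \<notin> poles_k k \<longrightarrow>
      norm x + norm y < 1 / k \<longrightarrow>
        appell_F2_k k \<alpha> \<beta> \<beta>' \<gamma> \<beta>' x y
          = (1 - of_real k * y) powr (- (\<alpha> / of_real k))
            * hyp2F1_k k \<alpha> \<beta> \<gamma> (x / (1 - of_real k * y)))"
  using appell_F1_k_reduction[OF assms] appell_F2_k_reduction[OF assms]
  by (metis appell_F1_k_swap appell_F2_k_swap add.commute)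

end
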